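(* Let $W \subseteq \ell_\infty^*$ be a set which does not contain any set equivalent to the canonical basis of $\ell_1(\mathfrak{c})$. Then $W$ fails the Orlicz-Thomas (OT) property.
   Context: All Banach spaces are real. $\mathfrak{c}=|\mathbb{R}|$ is the cardinality of the continuum; $\ell_1(\mathfrak{c})$ means $\ell_1(I)$ for an index set $I$ with $|I|=\mathfrak{c}$. For a Banach space $X$ and a non-empty set $I$, a set $\{x_i : i\in I\}\subseteq X$ is said to be equivalent to the canonical basis of $\ell_1(I)$ if it is bounded and there is a constant $c>0$ such that $\left\|\sum_{i\in I} a_i x_i\right\|\ge c\sum_{i\in I}|a_i|$ for every $(a_i)_{i\in I}\in \ell_1(I)$. For a $\sigma$-algebra $\Sigma$ (of subsets of some set) and a Banach space $X$, ${\rm ca}(\Sigma,X)$ is the set of all countably additive (for the norm topology) $X$-valued measures defined on $\Sigma$, and ${\rm ca}(\Sigma)={\rm ca}(\Sigma,\mathbb{R})$. A set $W\subseteq X^*$ has the Orlicz-Thomas (OT) property if, for every map $\nu:\Sigma\to X$ defined on a $\sigma$-algebra $\Sigma$, we have $\nu\in {\rm ca}(\Sigma,X)$ whenever $x^*\circ\nu\in {\rm ca}(\Sigma)$ for all $x^*\in W$. Here $X=\ell_\infty$. *)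

theory Defs
  imports "HOL-Analysis.Analysis"
begin

text \<open>
  The library has completeness only for metric domains, but \<^typ>\<open>nat\<close> is not an instance of
  \<^class>\<open>metric_space\<close>.
\<close>

instance bcontfun :: (topological_space, complete_space) complete_space
proof
  fix X :: "nat \<Rightarrow> 'a \<Rightarrow>\<^sub>C 'b"
  assume C: "Cauchy X"
  have "uniformly_Cauchy_on UNIV (\<lambda>n. apply_bcontfun (X n))"
    unfolding uniformly_Cauchy_on_def
  proof (intro allI impI)
    fix e :: real assume "e > 0"
    then obtain M where "\<And>m n. m \<ge> M \<Longrightarrow> n \<ge> M \<Longrightarrow> dist (X m) (X n) < e"
      using C unfolding Cauchy_def by blast
    then show "\<exists>M. \<forall>x\<in>UNIV. \<forall>m\<ge>M. \<forall>n\<ge>M. dist (X m x) (X n x) < e"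
      using dist_bounded le_less_trans by blast
  qed
  then obtain l where "uniform_limit UNIV (\<lambda>n. apply_bcontfun (X n)) l sequentially"
    using Cauchy_uniformly_convergent unfolding uniformly_convergent_on_def by blast
  then show "convergent X"
    by (rule uniform_limit_bcontfunE) (auto intro: convergentI)
qed

instance bcontfun :: (topological_space, banach) banach ..

text \<open>
  Since \<^typ>\<open>nat\<close> carries the discrete topology, the bounded continuous functions on it
  are exactly the bounded real sequences, with the supremum norm.
\<close>

type_synonym linfty = "nat \<Rightarrow>\<^sub>C real"

definition equiv_l1_basis :: "'i set \<Rightarrow> ('i \<Rightarrow> 'a::banach) \<Rightarrow> bool" where
  "equiv_l1_basis I x \<longleftrightarrow>
     bounded (x ` I) \<and>
     (\<exists>c>0. \<forall>a::'i \<Rightarrow> real. (\<lambda>i. \<bar>a i\<bar>) summable_on I \<longrightarrow>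
        norm (\<Sum>\<^sub>\<infinity>i\<in>I. a i *\<^sub>R x i) \<ge> c * (\<Sum>\<^sub>\<infinity>i\<in>I. \<bar>a i\<bar>))"

text \<open>
  A measure on \<open>\<Sigma>\<close> is represented by a total function on \<^typ>\<open>'i set\<close> whose values outside
  \<open>\<Sigma>\<close> are irrelevant. The condition forces \<open>\<nu> {} = 0\<close>, as a convergent constant series vanishes.
\<close>

definition ca :: "'i set set \<Rightarrow> ('i set \<Rightarrow> 'a::real_normed_vector) set" where
  "ca \<Sigma> = {\<nu>. \<forall>A::nat \<Rightarrow> 'i set. range A \<subseteq> \<Sigma> \<longrightarrow> disjoint_family A \<longrightarrow>
                 (\<lambda>n. \<nu> (A n)) sums \<nu> (\<Union>n. A n)}"

text \<open>
  HOL cannot quantify over the type of the underlying set of the \<open>\<sigma>\<close>-algebra inside a definition,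
  so that type is a parameter. By \<open>OT_property_nat_imp\<close> below, the property for \<^typ>\<open>nat\<close>
  implies it for every type; hence failure for \<^typ>\<open>nat\<close> is the same as failure for
  some \<open>\<sigma>\<close>-algebra on some set.
\<close>

definition OT_property :: "'i itself \<Rightarrow> ('a::banach \<Rightarrow>\<^sub>L real) set \<Rightarrow> bool" where
  "OT_property _ W \<longleftrightarrow>
     (\<forall>(\<Omega>::'i set) \<Sigma> (\<nu>::'i set \<Rightarrow> 'a). sigma_algebra \<Omega> \<Sigma> \<longrightarrow>
        (\<forall>f\<in>W. blinfun_apply f \<circ> \<nu> \<in> ca \<Sigma>) \<longrightarrow> \<nu> \<in> ca \<Sigma>)"

lemma ca_D:
  "\<nu> \<in> ca \<Sigma> \<Longrightarrow> range A \<subseteq> \<Sigma> \<Longrightarrow> disjoint_family A \<Longrightarrow> (\<lambda>n. \<nu> (A n)) sums \<nu> (\<Union>n. A n)"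
  by (simp add: ca_def)

lemma OT_property_nat_imp:
  fixes W :: "('a::banach \<Rightarrow>\<^sub>L real) set"
  assumes "OT_property TYPE(nat) W"
  shows "OT_property TYPE('i) W"
  unfolding OT_property_def
proof (intro allI impI)
  fix \<Omega> :: "'i set" and \<Sigma> and \<nu> :: "'i set \<Rightarrow> 'a"
  assume "sigma_algebra \<Omega> \<Sigma>" and f: "\<forall>f\<in>W. blinfun_apply f \<circ> \<nu> \<in> ca \<Sigma>"
  then interpret sigma_algebra \<Omega> \<Sigma> by simp
  have "(\<lambda>n. \<nu> (A n)) sums \<nu> (\<Union>n. A n)"
    if A: "range A \<subseteq> \<Sigma>" "disjoint_family A" for A :: "nat \<Rightarrow> 'i set"
  proof -
    define \<mu> where "\<mu> B = \<nu> (\<Union>n\<in>B. A n)" for B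
    have "blinfun_apply g \<circ> \<mu> \<in> ca (Pow UNIV)" if g: "g \<in> W" for g
      unfolding ca_def
    proof (intro CollectI allI impI)
      fix B :: "nat \<Rightarrow> nat set" assume B: "disjoint_family B"
      let ?C = "\<lambda>k. \<Union>n\<in>B k. A n"
      have "range ?C \<subseteq> \<Sigma>" using A(1) by blast
      moreover have "disjoint_family ?C"
        unfolding disjoint_family_on_def
      proof (intro ballI impI)
        fix k l :: nat assume "k \<noteq> l"
        then have disj: "B k \<inter> B l = {}" using B by (simp add: disjoint_family_on_def)
        show "?C k \<inter> ?C l = {}"
        proof (rule equals0I)
          fix z assume "z \<in> ?C k \<inter> ?C l"
          then obtain m n where mn: "m \<in> B k" "n \<in> B l" "z \<in> A m" "z \<in> A n" by auto
          then have "m \<noteq> n" using disj by auto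
          then have "A m \<inter> A n = {}" using A(2) by (simp add: disjoint_family_on_def)
          then show False using mn by auto
        qed
      qed
      ultimately have "(\<lambda>k. (blinfun_apply g \<circ> \<nu>) (?C k)) sums (blinfun_apply g \<circ> \<nu>) (\<Union>k. ?C k)"
        by (rule ca_D[OF f[rule_format, OF g]])
      moreover have "(\<Union>k. ?C k) = (\<Union>n\<in>(\<Union>k. B k). A n)" by blast
      ultimately show "(\<lambda>n. (blinfun_apply g \<circ> \<mu>) (B n)) sums (blinfun_apply g \<circ> \<mu>) (\<Union>n. B n)"
        by (simp only: \<mu>_def comp_apply)
    qed
    then have "\<mu> \<in> ca (Pow UNIV)"
      using assms sigma_algebra_Pow[of "UNIV :: nat set"] by (simp add: OT_property_def)
    moreover have "disjoint_family (\<lambda>n::nat. {n})" by (simp add: disjoint_family_on_def)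
    ultimately have "(\<lambda>n. \<mu> {n}) sums \<mu> (\<Union>n. {n})" using ca_D by (metis Pow_UNIV subset_UNIV)
    then show ?thesis by (simp add: \<mu>_def)
  qed
  then show "\<nu> \<in> ca \<Sigma>" by (simp add: ca_def)
qed

end

theory Submission
  imports Defs "HOL-Library.Nat_Bijection"
begin

text \<open>
  A functional \<open>f\<close> on \<open>\<ell>\<^sub>\<infinity>\<close> induces the finitely additive measure \<open>B \<mapsto> f (1\<^sub>B)\<close>. Subtracting its
  countably additive part \<open>B \<mapsto> \<Sum>n\<in>B. f (e\<^sub>n)\<close> leaves the singular part \<open>sing f\<close>, which vanishes
  on finite sets.

  Suppose that \<open>W\<close> has the Orlicz-Thomas property. For infinite \<open>A\<close>, the measure \<open>B \<mapsto> 1\<^bsub>A \<inter> B\<^esub>\<close>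
  with values in \<open>\<ell>\<^sub>\<infinity>\<close> is not countably additive, so some \<open>f \<in> W\<close> has \<open>sing f B \<noteq> 0\<close> for
  some \<open>B \<subseteq> A\<close> (\<open>OT_imp_singular\<close>). Applied to an almost disjoint family of size continuum, this
  gives functionals \<open>f\<^sub>x \<in> W\<close> and almost disjoint sets \<open>B\<^sub>x\<close> with \<open>sing f\<^sub>x B\<^sub>x \<noteq> 0\<close>. The
  continuum has uncountable cofinality (\<open>koenig_countable_cover\<close>), so on a subfamily of the same
  size \<open>\<parallel>f\<^sub>x\<parallel>\<close> is bounded and \<open>\<bar>sing f\<^sub>x B\<^sub>x\<bar> \<ge> \<delta> > 0\<close>.

  Almost disjoint sets act as disjoint ones for the singular part, whence
  \<open>\<Sum>y. \<bar>sing f\<^sub>x B\<^sub>y\<bar> \<le> \<parallel>f\<^sub>x\<parallel>\<close> (\<open>sum_abs_sing_le_norm\<close>). Rosenthal's disjointification lemma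
  (\<open>rosenthal_disjointification\<close>) then yields a further subfamily of size continuum with
  \<open>\<Sum>y\<noteq>x. \<bar>sing f\<^sub>x B\<^sub>y\<bar> \<le> \<delta>/2\<close>. Testing \<open>\<Sum>x. a\<^sub>x f\<^sub>x\<close> on signed sums of the indicators of the
  sets \<open>B\<^sub>x\<close>, made disjoint by deleting a finite initial segment, gives the lower bound
  \<open>\<delta>/2 \<cdot> \<Sum>x. \<bar>a\<^sub>x\<bar>\<close> for its norm (\<open>norm_sum_ge_of_singular_parts\<close>).
\<close>

section \<open>Indicator sequences and the singular part of a functional\<close>

text \<open>The indicator sequence of a set of natural numbers, as an element of \<open>\<ell>\<^sub>\<infinity>\<close>.\<close>

definition ind :: "nat set \<Rightarrow> linfty" where
  "ind A = Bcontfun (indicator A)"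

lemma apply_ind [simp]: "apply_bcontfun (ind A) = indicator A"
  unfolding ind_def
  by (rule Bcontfun_inverse, rule bcontfun_normI[where b = 1]) (auto simp: indicator_def)

lemma apply_bcontfun_sum: "apply_bcontfun (\<Sum>i\<in>F. h i) x = (\<Sum>i\<in>F. apply_bcontfun (h i) x)"
  by (induction F rule: infinite_finite_induct) auto

lemma ind_Un: "A \<inter> B = {} \<Longrightarrow> ind (A \<union> B) = ind A + ind B"
  by (rule bcontfun_eqI) (auto simp: indicator_def)

lemma norm_ind_singleton: "norm (ind {n}) = 1"
proof (rule antisym)
  show "norm (ind {n}) \<le> 1" by (rule norm_bound) (auto simp: indicator_def)
  show "1 \<le> norm (ind {n})" using norm_bounded[of "ind {n}" n] by simp
qed

lemma norm_sum_ind_le: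
  assumes "disjoint_family_on B F" and s: "\<And>i. i \<in> F \<Longrightarrow> \<bar>s i\<bar> \<le> 1"
  shows "norm (\<Sum>i\<in>F. s i *\<^sub>R ind (B i)) \<le> 1"
proof (cases "finite F")
  case True
  show ?thesis
  proof (rule norm_bound)
    fix x
    let ?v = "\<Sum>i\<in>F. s i * indicator (B i) x"
    have "\<bar>?v\<bar> \<le> 1"
    proof (cases "\<exists>i\<in>F. x \<in> B i")
      case True
      then obtain i where i: "i \<in> F" "x \<in> B i" by blast
      have zero: "s j * indicator (B j) x = 0" if "j \<in> F - {i}" for j
      proof -
        have "B i \<inter> B j = {}" using assms(1) i that by (auto simp: disjoint_family_on_def)
        then show ?thesis using i by (auto simp: indicator_def)
      qed
      have "(\<Sum>j\<in>F - {i}. s j * indicator (B j) x) = 0"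
        using zero by (rule sum.neutral[OF ballI])
      then have "?v = s i * indicator (B i) x"
        using sum.remove[OF \<open>finite F\<close> i(1), of "\<lambda>j. s j * indicator (B j) x"] by linarith
      then show ?thesis using i s by simp
    next
      case False
      then have "?v = 0" by (intro sum.neutral) auto
      then show ?thesis by simp
    qed
    then show "norm (apply_bcontfun (\<Sum>i\<in>F. s i *\<^sub>R ind (B i)) x) \<le> 1"
      by (simp add: apply_bcontfun_sum)
  qed
qed simp

lemma norm_atoms_summable_on:
  fixes f :: "linfty \<Rightarrow>\<^sub>L real"
  shows "(\<lambda>n. norm (f (ind {n}))) summable_on B"
proof (rule nonneg_bdd_above_summable_on)
  show "bdd_above (sum (\<lambda>n. norm (f (ind {n}))) ` {F. F \<subseteq> B \<and> finite F})"
  proof (intro bdd_aboveI2)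
    fix F assume "F \<in> {F. F \<subseteq> B \<and> finite F}"
    let ?v = "\<Sum>n\<in>F. sgn (f (ind {n})) *\<^sub>R ind {n}"
    have "(\<Sum>n\<in>F. norm (f (ind {n}))) = f ?v"
      by (simp add: blinfun.sum_right blinfun.scaleR_right abs_sgn mult.commute)
    also have "\<dots> \<le> norm f * norm ?v"
      using norm_blinfun[of f ?v] by simp
    also have "\<dots> \<le> norm f * 1"
      by (intro mult_left_mono norm_sum_ind_le)
        (auto simp: disjoint_family_on_def abs_sgn_eq)
    finally show "(\<Sum>n\<in>F. norm (f (ind {n}))) \<le> norm f" by simp
  qed
qed auto

text \<open>
  The singular (purely finitely additive) part of the measure \<open>B \<mapsto> f (1\<^sub>B)\<close>: what remains after
  removing the point masses \<open>f (e\<^sub>n)\<close>, whose sum converges absolutely.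
\<close>

definition sing :: "(linfty \<Rightarrow>\<^sub>L real) \<Rightarrow> nat set \<Rightarrow> real" where
  "sing f B = f (ind B) - (\<Sum>\<^sub>\<infinity>n\<in>B. f (ind {n}))"

text \<open>
  Deleting longer and longer initial segments of \<open>B\<close> removes the contribution of the point masses.
  Linearity and the norm estimate for the singular part come from this limit.
\<close>

lemma sing_tendsto:
  fixes f :: "linfty \<Rightarrow>\<^sub>L real"
  shows "(\<lambda>N. f (ind (B - {..<N}))) \<longlonglongrightarrow> sing f B"
proof -
  let ?g = "\<lambda>n. f (ind {n})"
  have "(?g has_sum infsum ?g B) B"
    using abs_summable_summable[OF norm_atoms_summable_on] by (rule has_sum_infsum)
  then have "((\<lambda>n. if n \<in> B then ?g n else 0) has_sum infsum ?g B) UNIV"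
    by (subst has_sum_cong_neutral[where T = B and g = ?g]) auto
  then have "(\<lambda>N. \<Sum>n<N. if n \<in> B then ?g n else 0) \<longlonglongrightarrow> infsum ?g B"
    using has_sum_imp_sums sums_def by blast
  then have "(\<lambda>N. f (ind B) - (\<Sum>n<N. if n \<in> B then ?g n else 0)) \<longlonglongrightarrow> sing f B"
    unfolding sing_def by (intro tendsto_intros)
  moreover have "f (ind (B - {..<N})) = f (ind B) - (\<Sum>n<N. if n \<in> B then ?g n else 0)" for N
  proof (induction N)
    case (Suc N)
    show ?case
    proof (cases "N \<in> B")
      case True
      then have "B - {..<N} = (B - {..<Suc N}) \<union> {N}" by auto
      then have "ind (B - {..<N}) = ind (B - {..<Suc N}) + ind {N}"
        by (simp only:) (rule ind_Un, auto)
      then have "f (ind (B - {..<N})) = f (ind (B - {..<Suc N})) + ?g N"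
        by (simp only: blinfun.add_right)
      then show ?thesis using Suc.IH True by simp
    next
      case False
      then have "B - {..<Suc N} = B - {..<N}" by (auto simp: less_Suc_eq)
      then show ?thesis using Suc.IH False by simp
    qed
  qed simp
  ultimately show ?thesis by simp
qed

lemma sing_sum:
  fixes f :: "'i \<Rightarrow> linfty \<Rightarrow>\<^sub>L real"
  shows "sing (\<Sum>i\<in>F. a i *\<^sub>R f i) B = (\<Sum>i\<in>F. a i * sing (f i) B)"
proof (rule LIMSEQ_unique[OF sing_tendsto])
  have "(\<lambda>N. \<Sum>i\<in>F. a i * f i (ind (B - {..<N}))) \<longlonglongrightarrow> (\<Sum>i\<in>F. a i * sing (f i) B)"
    by (intro tendsto_intros sing_tendsto)
  then show "(\<lambda>N. (\<Sum>i\<in>F. a i *\<^sub>R f i) (ind (B - {..<N}))) \<longlonglongrightarrow> (\<Sum>i\<in>F. a i * sing (f i) B)"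
    by (simp add: blinfun.sum_left blinfun.scaleR_left)
qed

text \<open>
  Finitely many almost disjoint sets become disjoint when an initial segment is deleted, which does
  not affect the limits defining the singular part.
\<close>

lemma sum_sing_le_norm:
  fixes B :: "'i \<Rightarrow> nat set"
  assumes F: "finite F" and s: "\<And>i. i \<in> F \<Longrightarrow> \<bar>s i\<bar> \<le> 1"
    and ad: "\<And>i j. i \<in> F \<Longrightarrow> j \<in> F \<Longrightarrow> i \<noteq> j \<Longrightarrow> finite (B i \<inter> B j)"
  shows "(\<Sum>i\<in>F. s i * sing f (B i)) \<le> norm f"
proof (rule tendsto_upperbound)
  show "(\<lambda>N. \<Sum>i\<in>F. s i * f (ind (B i - {..<N}))) \<longlonglongrightarrow> (\<Sum>i\<in>F. s i * sing f (B i))"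
    by (intro tendsto_intros sing_tendsto)
  define E where "E = (\<Union>i\<in>F. \<Union>j\<in>F - {i}. B i \<inter> B j)"
  have "finite E" unfolding E_def using F by (intro finite_UN_I finite_Diff) (use ad in auto)
  then obtain M where M: "E \<subseteq> {..<M}" by (auto simp: finite_nat_iff_bounded)
  show "\<forall>\<^sub>F N in sequentially. (\<Sum>i\<in>F. s i * f (ind (B i - {..<N}))) \<le> norm f"
  proof (rule eventually_sequentiallyI)
    fix N assume N: "M \<le> N"
    let ?v = "\<Sum>i\<in>F. s i *\<^sub>R ind (B i - {..<N})"
    have "disjoint_family_on (\<lambda>i. B i - {..<N}) F"
      unfolding disjoint_family_on_def
    proof (intro ballI impI)
      fix i j assume "i \<in> F" "j \<in> F" "i \<noteq> j"
      then have "B i \<inter> B j \<subseteq> E" by (auto simp: E_def)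
      also have "\<dots> \<subseteq> {..<N}" using M N by auto
      finally have "B i \<inter> B j \<subseteq> {..<N}" .
      then show "(B i - {..<N}) \<inter> (B j - {..<N}) = {}" by blast
    qed
    then have "norm ?v \<le> 1" using s by (rule norm_sum_ind_le)
    then have "norm f * norm ?v \<le> norm f * 1" by (intro mult_left_mono) auto
    moreover have "f ?v = (\<Sum>i\<in>F. s i * f (ind (B i - {..<N})))"
      by (simp add: blinfun.sum_right blinfun.scaleR_right)
    ultimately show "(\<Sum>i\<in>F. s i * f (ind (B i - {..<N}))) \<le> norm f"
      using norm_blinfun[of f ?v] by simp
  qed
qed simp

corollary sum_abs_sing_le_norm:
  fixes B :: "'i \<Rightarrow> nat set"
  assumes "finite F" and "\<And>i j. i \<in> F \<Longrightarrow> j \<in> F \<Longrightarrow> i \<noteq> j \<Longrightarrow> finite (B i \<inter> B j)"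
  shows "(\<Sum>i\<in>F. \<bar>sing f (B i)\<bar>) \<le> norm f"
proof -
  have "(\<Sum>i\<in>F. sgn (sing f (B i)) * sing f (B i)) \<le> norm f"
    using assms by (intro sum_sing_le_norm) (auto simp: abs_sgn_eq)
  then show ?thesis by (simp add: abs_sgn mult.commute)
qed

section \<open>A vector measure that detects the singular part\<close>

lemma ca_infsum:
  fixes g :: "nat \<Rightarrow> real"
  assumes g: "\<And>B. g summable_on B"
  shows "(\<lambda>B. infsum g (A \<inter> B)) \<in> ca (Pow UNIV)"
  unfolding ca_def
proof (intro CollectI allI impI)
  fix C :: "nat \<Rightarrow> nat set" assume C: "disjoint_family C"
  let ?S = "Sigma UNIV (\<lambda>k. A \<inter> C k)"
  have "inj_on snd ?S"
    using C by (fastforce simp: inj_on_def disjoint_family_on_def)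
  moreover have "snd ` ?S = A \<inter> (\<Union>k. C k)" by force
  ultimately have "(g \<circ> snd has_sum infsum g (A \<inter> (\<Union>k. C k))) ?S"
    using has_sum_reindex[of snd ?S g] has_sum_infsum[OF g, of "A \<inter> (\<Union>k. C k)"] by metis
  then have "((\<lambda>k. infsum g (A \<inter> C k)) has_sum infsum g (A \<inter> (\<Union>k. C k))) UNIV"
    by (rule has_sum_SigmaD) (simp add: has_sum_infsum[OF g])
  then show "(\<lambda>k. infsum g (A \<inter> C k)) sums infsum g (A \<inter> (\<Union>k. C k))"
    by (rule has_sum_imp_sums)
qed

text \<open>
  The measure \<open>B \<mapsto> 1\<^bsub>A \<inter> B\<^esub>\<close> is not countably additive, since its values at the points of \<open>A\<close>
  have norm 1; it becomes countably additive under a functional with no singular part on \<open>A\<close>.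
\<close>

lemma OT_imp_singular:
  assumes OT: "OT_property TYPE(nat) W" and A: "infinite A"
  shows "\<exists>f\<in>W. \<exists>B\<subseteq>A. sing f B \<noteq> 0"
proof (rule ccontr)
  assume "\<not> (\<exists>f\<in>W. \<exists>B\<subseteq>A. sing f B \<noteq> 0)"
  then have zero: "sing f (A \<inter> B) = 0" if "f \<in> W" for f B using that by simp
  let ?\<nu> = "\<lambda>B. ind (A \<inter> B)"
  have "blinfun_apply f \<circ> ?\<nu> \<in> ca (Pow UNIV)" if "f \<in> W" for f
  proof -
    have "blinfun_apply f \<circ> ?\<nu> = (\<lambda>B. \<Sum>\<^sub>\<infinity>n\<in>A \<inter> B. f (ind {n}))"
      using zero[OF that] by (auto simp: sing_def fun_eq_iff)
    then show ?thesis
      using ca_infsum abs_summable_summable[OF norm_atoms_summable_on] by simp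
  qed
  then have "?\<nu> \<in> ca (Pow UNIV)"
    using OT sigma_algebra_Pow[of "UNIV :: nat set"] unfolding OT_property_def by blast
  then have "(\<lambda>n. ?\<nu> {n}) sums ?\<nu> (\<Union>n. {n})"
    by (rule ca_D) (auto simp: disjoint_family_on_def)
  then have "(\<lambda>n. norm (?\<nu> {n})) \<longlonglongrightarrow> 0"
    using sums_summable summable_LIMSEQ_zero tendsto_norm_zero by blast
  then have "\<forall>\<^sub>F n in sequentially. norm (?\<nu> {n}) < 1"
    by (rule order_tendstoD) simp
  then obtain N where N: "\<And>n. n \<ge> N \<Longrightarrow> norm (?\<nu> {n}) < 1"
    by (auto simp: eventually_sequentially)
  obtain n where "n \<ge> N" "n \<in> A"
    using A by (meson infinite_nat_iff_unbounded_le)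
  then show False using N[of n] norm_ind_singleton[of n] by simp
qed

section \<open>Combinatorics of the continuum\<close>

text \<open>
  Subsets of the natural numbers serve as index set of size continuum: sequences and pairs of them
  are coded as single ones, so sizes need only be compared through injections.
\<close>

lemma inj_real_nat_set: "\<exists>h :: real \<Rightarrow> nat set. inj h"
proof
  show "inj (\<lambda>r::real. to_nat ` {q::rat. of_rat q < r})"
  proof (rule linorder_injI)
    fix r s :: real assume "r < s"
    \<comment> \<open>Distinct reals have distinct Dedekind cuts.\<close>
    then obtain q :: rat where "r < of_rat q" "of_rat q < s" using of_rat_dense by blast
    then have "q \<notin> {q. of_rat q < r}" "q \<in> {q. of_rat q < s}" by auto
    then have "{q::rat. of_rat q < r} \<noteq> {q. of_rat q < s}" by blast
    then show "to_nat ` {q::rat. of_rat q < r} \<noteq> to_nat ` {q::rat. of_rat q < s}"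
      by (simp add: inj_image_eq_iff)
  qed
qed

lemma inj_seq_nat_set: "inj (\<lambda>x :: nat \<Rightarrow> nat set. {prod_encode (n, k) |n k. k \<in> x n})"
  (is "inj ?h")
proof (rule injI)
  fix x y assume eq: "?h x = ?h y"
  have *: "k \<in> z n \<longleftrightarrow> prod_encode (n, k) \<in> ?h z" for z and k n :: nat by auto
  show "x = y"
    by (intro ext set_eqI, rule trans[OF * trans[OF _ *[symmetric]]]) (simp only: eq)
qed

lemma inj_pair_nat_set: "\<exists>j :: nat set \<times> nat set \<Rightarrow> nat set. inj j"
proof
  have "inj (\<lambda>(a, b). \<lambda>n::nat. if n = 0 then a else b :: nat set)"
    by (auto simp: inj_def fun_eq_iff split: if_splits)
  then show "inj ((\<lambda>x. {prod_encode (n, k) |n k. k \<in> x n}) \<circ> (\<lambda>(a, b). \<lambda>n::nat. if n = 0 then a else b))"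
    using inj_compose inj_seq_nat_set by blast
qed

text \<open>
  To \<open>S\<close> corresponds the set of its codes of initial segments: two different sets share only
  finitely many initial segments, namely those that end before their first difference. The family is
  indexed by sequences so that \<open>koenig_countable_cover\<close> applies to it.
\<close>

lemma almost_disjoint_family:
  "\<exists>A :: (nat \<Rightarrow> nat set) \<Rightarrow> nat set. (\<forall>x. infinite (A x)) \<and> (\<forall>x y. x \<noteq> y \<longrightarrow> finite (A x \<inter> A y))"
proof -
  define D :: "nat set \<Rightarrow> nat set"
    where "D S = range (\<lambda>n. prod_encode (n, set_encode (S \<inter> {..<n})))" for S
  have inf: "infinite (D S)" for S
    unfolding D_def by (rule range_inj_infinite) (auto simp: inj_def)
  have fin: "finite (D S \<inter> D T)" if "S \<noteq> T" for S T
  proof -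
    from that obtain k where k: "k \<in> S \<longleftrightarrow> k \<notin> T" by blast
    have "D S \<inter> D T \<subseteq> (\<lambda>n. prod_encode (n, set_encode (S \<inter> {..<n}))) ` {..k}"
    proof
      fix z assume "z \<in> D S \<inter> D T"
      then obtain n where z: "z = prod_encode (n, set_encode (S \<inter> {..<n}))"
        and "set_encode (S \<inter> {..<n}) = set_encode (T \<inter> {..<n})"
        unfolding D_def by auto
      then have "S \<inter> {..<n} = T \<inter> {..<n}" by (simp add: set_encode_eq)
      then have "\<not> k < n" using k by auto
      then show "z \<in> (\<lambda>n. prod_encode (n, set_encode (S \<inter> {..<n}))) ` {..k}"
        using z by auto
    qed
    then show ?thesis by (rule finite_subset) simp
  qed
  obtain h :: "(nat \<Rightarrow> nat set) \<Rightarrow> nat set" where "inj h" using inj_seq_nat_set by blast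
  then have "finite (D (h x) \<inter> D (h y))" if "x \<noteq> y" for x y
    using that by (intro fin) (simp add: inj_eq)
  then have "(\<forall>x. infinite (D (h x))) \<and> (\<forall>x y. x \<noteq> y \<longrightarrow> finite (D (h x) \<inter> D (h y)))"
    using inf by simp
  then show ?thesis by (intro exI[of _ "\<lambda>x. D (h x)"])
qed

text \<open>
  Koenig's argument that the continuum has uncountable cofinality: if the sequences over \<open>'a\<close> are
  covered by countably many sets, then one of these sets has at least as many elements as \<open>'a\<close>,
  because some \<open>S n\<close> projects onto all of \<open>'a\<close> in coordinate \<open>n\<close>; otherwise a sequence whose
  \<open>n\<close>-th term is missed by \<open>S n\<close>, for each \<open>n\<close>, lies in none of the sets.
\<close>

lemma koenig_countable_cover:
  fixes S :: "nat \<Rightarrow> (nat \<Rightarrow> 'a) set"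
  assumes "(\<Union>n. S n) = UNIV"
  shows "\<exists>n. \<exists>\<iota> :: 'a \<Rightarrow> nat \<Rightarrow> 'a. inj \<iota> \<and> range \<iota> \<subseteq> S n"
proof -
  have "\<exists>n. (\<lambda>x. x n) ` S n = UNIV"
  proof (rule ccontr)
    assume "\<nexists>n. (\<lambda>x. x n) ` S n = UNIV"
    then have "\<exists>a. a \<notin> (\<lambda>x. x n) ` S n" for n by (metis UNIV_eq_I)
    then obtain x where "\<And>n. x n \<notin> (\<lambda>x. x n) ` S n" by metis
    then have "x \<notin> (\<Union>n. S n)" by blast
    then show False using assms by simp
  qed
  then obtain n where n: "(\<lambda>x. x n) ` S n = UNIV" by blast
  let ?\<iota> = "inv_into (S n) (\<lambda>x. x n)"
  have "inj ?\<iota>" using inj_on_inv_into[of UNIV "\<lambda>x. x n" "S n"] n by simp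
  moreover have "range ?\<iota> \<subseteq> S n" using inv_into_into[of _ "\<lambda>x. x n" "S n"] n by blast
  ultimately show ?thesis by blast
qed

section \<open>Disjointification\<close>

text \<open>
  Rosenthal's lemma for an arbitrary infinite index set, infinity being expressed by the pairing
  \<open>j\<close>: if the rows of a nonnegative matrix have uniformly bounded off-diagonal sums, then a
  submatrix indexed by a set of the same size has off-diagonal row sums at most \<open>\<epsilon>\<close>. The index set
  is split into blocks \<open>{j (c, x) | x}\<close> of full size. Either some block will do, or each block \<open>c\<close>
  contains a row \<open>\<psi> c\<close> with more than \<open>\<epsilon>\<close> of its off-diagonal sum inside the block. In the latter case
  passing to the rows and columns \<open>\<psi> c\<close> lowers the bound by \<open>\<epsilon>\<close>, so this happens at most \<open>k\<close> times.
\<close>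

lemma rosenthal_disjointification:
  fixes m :: "'a \<Rightarrow> 'a \<Rightarrow> real" and j :: "'a \<times> 'a \<Rightarrow> 'a"
  assumes j: "inj j" and m: "\<And>x y. m x y \<ge> 0" and \<epsilon>: "\<epsilon> > 0"
    and bound: "\<And>x F. finite F \<Longrightarrow> x \<notin> F \<Longrightarrow> (\<Sum>y\<in>F. m x y) \<le> real k * \<epsilon>"
  shows "\<exists>\<phi> :: 'a \<Rightarrow> 'a. inj \<phi> \<and> (\<forall>x F. finite F \<longrightarrow> x \<notin> F \<longrightarrow> (\<Sum>y\<in>F. m (\<phi> x) (\<phi> y)) \<le> \<epsilon>)"
  using m bound
proof (induction k arbitrary: m)
  case 0
  have "(\<Sum>y\<in>F. m x y) \<le> \<epsilon>" if "finite F" "x \<notin> F" for x F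
    using "0.prems"(2)[OF that] \<epsilon> by simp
  then show ?case by (intro exI[of _ id]) auto
next
  case (Suc k)
  show ?case
  proof (cases "\<exists>c. \<forall>x F. finite F \<longrightarrow> x \<notin> F \<longrightarrow> (\<Sum>y\<in>F. m (j (c, x)) (j (c, y))) \<le> \<epsilon>")
    case True
    then obtain c
      where c: "\<And>x F. finite F \<Longrightarrow> x \<notin> F \<Longrightarrow> (\<Sum>y\<in>F. m (j (c, x)) (j (c, y))) \<le> \<epsilon>"
      by blast
    have "inj (\<lambda>x. j (c, x))" by (rule injI) (auto dest: injD[OF j])
    then show ?thesis using c by blast
  next
    case False
    then have "\<forall>c. \<exists>x F. finite F \<and> x \<notin> F \<and> \<epsilon> < (\<Sum>y\<in>F. m (j (c, x)) (j (c, y)))"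
      by (simp add: not_le)
    then obtain d G where G: "\<And>c. finite (G c)" "\<And>c. d c \<notin> G c"
        "\<And>c. \<epsilon> < (\<Sum>y\<in>G c. m (j (c, d c)) (j (c, y)))"
      by metis
    define \<psi> where "\<psi> c = j (c, d c)" for c
    have \<psi>: "inj \<psi>" by (rule injI) (auto simp: \<psi>_def dest: injD[OF j])
    have "(\<Sum>y\<in>F. m (\<psi> x) (\<psi> y)) \<le> real k * \<epsilon>" if F: "finite F" "x \<notin> F" for x F
    proof -
      \<comment> \<open>The columns \<open>?H\<close> lie in block \<open>x\<close>, which meets \<open>range \<psi>\<close> only in \<open>\<psi> x\<close>.\<close>
      let ?H = "(\<lambda>y. j (x, y)) ` G x"
      have "(\<Sum>y\<in>F. m (\<psi> x) (\<psi> y)) + (\<Sum>y\<in>G x. m (\<psi> x) (j (x, y)))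
          = (\<Sum>z\<in>\<psi> ` F. m (\<psi> x) z) + (\<Sum>z\<in>?H. m (\<psi> x) z)"
        using inj_on_subset[OF \<psi>] by (simp add: sum.reindex inj_on_def inj_eq[OF j])
      also have "\<dots> = (\<Sum>z\<in>\<psi> ` F \<union> ?H. m (\<psi> x) z)"
        using F G(1) j by (subst sum.union_disjoint) (auto simp: \<psi>_def inj_eq)
      also have "\<dots> \<le> real (Suc k) * \<epsilon>"
        using F G(1,2) j by (intro Suc.prems) (auto simp: \<psi>_def inj_eq)
      finally show ?thesis using G(3)[of x] by (simp add: \<psi>_def algebra_simps)
    qed
    with Suc.prems(1) have "\<exists>\<phi> :: 'a \<Rightarrow> 'a. inj \<phi> \<and>
        (\<forall>x F. finite F \<longrightarrow> x \<notin> F \<longrightarrow> (\<Sum>y\<in>F. m (\<psi> (\<phi> x)) (\<psi> (\<phi> y))) \<le> \<epsilon>)"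
      by (rule Suc.IH)
    then obtain \<phi> :: "'a \<Rightarrow> 'a" where \<phi>: "inj \<phi> \<and>
        (\<forall>x F. finite F \<longrightarrow> x \<notin> F \<longrightarrow> (\<Sum>y\<in>F. m (\<psi> (\<phi> x)) (\<psi> (\<phi> y))) \<le> \<epsilon>)"
      by (rule exE)
    show ?thesis
    proof (intro exI[of _ "\<psi> \<circ> \<phi>"] conjI allI impI)
      show "inj (\<psi> \<circ> \<phi>)" using \<psi> conjunct1[OF \<phi>] by (rule inj_compose)
      show "(\<Sum>y\<in>F. m ((\<psi> \<circ> \<phi>) x) ((\<psi> \<circ> \<phi>) y)) \<le> \<epsilon>" if "finite F" "x \<notin> F" for x F
        using \<phi> that by simp
    qed
  qed
qed

section \<open>The lower estimate\<close>

text \<open>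
  The singular parts \<open>sing (f i) (B j)\<close> form a matrix dominated by its diagonal; the signs \<open>s\<close> below
  make its diagonal contributions add up.
\<close>

lemma norm_sum_ge_of_singular_parts:
  assumes F: "finite F"
    and ad: "\<And>i j. i \<in> F \<Longrightarrow> j \<in> F \<Longrightarrow> i \<noteq> j \<Longrightarrow> finite (B i \<inter> B j)"
    and diag: "\<And>i. i \<in> F \<Longrightarrow> \<delta> \<le> \<bar>sing (f i) (B i)\<bar>"
    and off: "\<And>i. i \<in> F \<Longrightarrow> (\<Sum>j\<in>F - {i}. \<bar>sing (f i) (B j)\<bar>) \<le> \<epsilon>"
  shows "(\<delta> - \<epsilon>) * (\<Sum>i\<in>F. \<bar>a i\<bar>) \<le> norm (\<Sum>i\<in>F. a i *\<^sub>R f i)"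
proof -
  define s where "s i = sgn (a i * sing (f i) (B i))" for i
  have s: "\<bar>s i\<bar> \<le> 1" for i by (simp add: s_def abs_sgn_eq)
  have "(\<delta> - \<epsilon>) * \<bar>a i\<bar> \<le> (\<Sum>j\<in>F. s j * (a i * sing (f i) (B j)))" if i: "i \<in> F" for i
  proof -
    have "\<bar>\<Sum>j\<in>F - {i}. s j * (a i * sing (f i) (B j))\<bar>
        \<le> (\<Sum>j\<in>F - {i}. \<bar>s j * (a i * sing (f i) (B j))\<bar>)"
      by (rule sum_abs)
    also have "\<dots> \<le> (\<Sum>j\<in>F - {i}. \<bar>a i\<bar> * \<bar>sing (f i) (B j)\<bar>)"
      using s by (intro sum_mono) (simp add: abs_mult mult_left_le_one_le)
    also have "\<dots> \<le> \<bar>a i\<bar> * \<epsilon>"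
      using off[OF i] by (simp add: mult_left_mono flip: sum_distrib_left)
    finally have "- (\<bar>a i\<bar> * \<epsilon>) \<le> (\<Sum>j\<in>F - {i}. s j * (a i * sing (f i) (B j)))" by linarith
    moreover have "s i * (a i * sing (f i) (B i)) = \<bar>a i\<bar> * \<bar>sing (f i) (B i)\<bar>"
      by (simp only: s_def mult.commute[of "sgn _"] flip: abs_sgn abs_mult)
    moreover have "\<bar>a i\<bar> * \<delta> \<le> \<bar>a i\<bar> * \<bar>sing (f i) (B i)\<bar>"
      using diag[OF i] by (intro mult_left_mono) auto
    ultimately show ?thesis using F i by (subst sum.remove[of F i]) (auto simp: algebra_simps)
  qed
  then have "(\<delta> - \<epsilon>) * (\<Sum>i\<in>F. \<bar>a i\<bar>) \<le> (\<Sum>i\<in>F. \<Sum>j\<in>F. s j * (a i * sing (f i) (B j)))"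
    unfolding sum_distrib_left by (intro sum_mono)
  also have "\<dots> = (\<Sum>j\<in>F. s j * sing (\<Sum>i\<in>F. a i *\<^sub>R f i) (B j))"
    by (subst sum.swap) (simp add: sing_sum sum_distrib_left)
  also have "\<dots> \<le> norm (\<Sum>i\<in>F. a i *\<^sub>R f i)"
    using F s ad by (rule sum_sing_le_norm)
  finally show ?thesis .
qed

text \<open>The lower estimate need only be verified for finitely supported coefficients.\<close>

lemma equiv_l1_basisI_finite:
  fixes x :: "'i \<Rightarrow> 'a::banach"
  assumes bdd: "\<And>i. i \<in> I \<Longrightarrow> norm (x i) \<le> K" and c: "c > 0"
    and fin: "\<And>a F. finite F \<Longrightarrow> F \<subseteq> I \<Longrightarrow> c * (\<Sum>i\<in>F. \<bar>a i\<bar>) \<le> norm (\<Sum>i\<in>F. a i *\<^sub>R x i)"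
  shows "equiv_l1_basis I x"
  unfolding equiv_l1_basis_def
proof (intro conjI exI[of _ c] allI impI)
  show "bounded (x ` I)" using bdd by (auto simp: bounded_iff)
  fix a :: "'i \<Rightarrow> real" assume a: "(\<lambda>i. \<bar>a i\<bar>) summable_on I"
  have "(\<lambda>i. norm (a i *\<^sub>R x i)) summable_on I"
  proof (rule Infinite_Sum.abs_summable_on_comparison_test')
    show "(\<lambda>i. K * \<bar>a i\<bar>) summable_on I" using a by (rule summable_on_cmult_right)
    show "norm (a i *\<^sub>R x i) \<le> K * \<bar>a i\<bar>" if "i \<in> I" for i
      using bdd[OF that] by (simp add: mult.commute[of K] mult_left_mono)
  qed
  then have "(\<lambda>i. a i *\<^sub>R x i) summable_on I" by (rule abs_summable_summable)
  then have "((\<lambda>F. norm (\<Sum>i\<in>F. a i *\<^sub>R x i)) \<longlongrightarrow> norm (\<Sum>\<^sub>\<infinity>i\<in>I. a i *\<^sub>R x i))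
      (finite_subsets_at_top I)"
    using has_sum_infsum has_sum_def tendsto_norm by blast
  moreover have "((\<lambda>F. c * (\<Sum>i\<in>F. \<bar>a i\<bar>)) \<longlongrightarrow> c * (\<Sum>\<^sub>\<infinity>i\<in>I. \<bar>a i\<bar>)) (finite_subsets_at_top I)"
    using has_sum_infsum[OF a] has_sum_def tendsto_mult_left by blast
  moreover have "\<forall>\<^sub>F F in finite_subsets_at_top I.
      c * (\<Sum>i\<in>F. \<bar>a i\<bar>) \<le> norm (\<Sum>i\<in>F. a i *\<^sub>R x i)"
    using fin by (intro eventually_finite_subsets_at_top_weakI) auto
  ultimately show "c * (\<Sum>\<^sub>\<infinity>i\<in>I. \<bar>a i\<bar>) \<le> norm (\<Sum>\<^sub>\<infinity>i\<in>I. a i *\<^sub>R x i)"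
    by (rule tendsto_le[OF finite_subsets_at_top_neq_bot])
qed (rule c)

theorem theorem3p15:
  fixes W :: "(linfty \<Rightarrow>\<^sub>L real) set"
  assumes "\<not> (\<exists>x :: real \<Rightarrow> (linfty \<Rightarrow>\<^sub>L real). range x \<subseteq> W \<and> equiv_l1_basis UNIV x)"
  shows "\<not> OT_property TYPE(nat) W"
proof
  assume OT: "OT_property TYPE(nat) W"
  obtain A :: "(nat \<Rightarrow> nat set) \<Rightarrow> nat set"
    where A: "\<And>x. infinite (A x)" "\<And>x y. x \<noteq> y \<Longrightarrow> finite (A x \<inter> A y)"
    using almost_disjoint_family by metis
  have "\<forall>x. \<exists>f B. f \<in> W \<and> B \<subseteq> A x \<and> sing f B \<noteq> 0"
    using OT_imp_singular[OF OT A(1)] by blast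
  then obtain f B where f: "\<And>x. f x \<in> W" and B: "\<And>x. B x \<subseteq> A x"
    and sing: "\<And>x. sing (f x) (B x) \<noteq> 0"
    by metis
  have ad: "finite (B x \<inter> B y)" if "x \<noteq> y" for x y
    using A(2)[OF that] B by (meson Int_mono finite_subset)
  \<comment> \<open>On \<open>S n\<close> the norms are bounded above and the singular parts bounded away from 0.\<close>
  define S where "S n = {x. norm (f x) \<le> real (Suc n) \<and> inverse (real (Suc n)) \<le> \<bar>sing (f x) (B x)\<bar>}" for n
  have "x \<in> (\<Union>n. S n)" for x
  proof -
    obtain n1 where n1: "norm (f x) \<le> real n1" using real_arch_simple by blast
    obtain n2 where n2: "inverse (real (Suc n2)) < \<bar>sing (f x) (B x)\<bar>"
      using reals_Archimedean[of "\<bar>sing (f x) (B x)\<bar>"] sing[of x] by auto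
    have "inverse (real (Suc (max n1 n2))) \<le> inverse (real (Suc n2))"
      by (intro le_imp_inverse_le) auto
    with n2 have "inverse (real (Suc (max n1 n2))) \<le> \<bar>sing (f x) (B x)\<bar>" by linarith
    moreover have "norm (f x) \<le> real (Suc (max n1 n2))" using n1 by linarith
    ultimately have "x \<in> S (max n1 n2)" unfolding S_def by blast
    then show ?thesis by blast
  qed
  then obtain n and \<iota> :: "nat set \<Rightarrow> nat \<Rightarrow> nat set" where \<iota>: "inj \<iota>" "range \<iota> \<subseteq> S n"
    using koenig_countable_cover[of S] by blast
  define \<delta> where "\<delta> = inverse (real (Suc n))"
  have \<delta>: "\<delta> > 0" by (simp add: \<delta>_def)
  obtain k where k: "real (Suc n) / (\<delta> / 2) \<le> real k" using real_arch_simple by blast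
  define m where "m a b = \<bar>sing (f (\<iota> a)) (B (\<iota> b))\<bar>" for a b
  have bound: "(\<Sum>b\<in>F. m a b) \<le> real k * (\<delta> / 2)" if "finite F" "a \<notin> F" for a F
  proof -
    have "(\<Sum>b\<in>F. m a b) \<le> norm (f (\<iota> a))"
      unfolding m_def using that(1) by (intro sum_abs_sing_le_norm ad) (simp_all add: inj_eq[OF \<iota>(1)])
    also have "\<dots> \<le> real (Suc n)" using \<iota>(2) by (auto simp: S_def)
    also have "\<dots> \<le> real k * (\<delta> / 2)" using k \<delta> by (simp add: field_simps)
    finally show ?thesis .
  qed
  obtain j :: "nat set \<times> nat set \<Rightarrow> nat set" where j: "inj j"
    using inj_pair_nat_set by blast
  have "\<exists>\<phi> :: nat set \<Rightarrow> nat set. inj \<phi> \<and>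
      (\<forall>a F. finite F \<longrightarrow> a \<notin> F \<longrightarrow> (\<Sum>b\<in>F. m (\<phi> a) (\<phi> b)) \<le> \<delta> / 2)"
    using j by (rule rosenthal_disjointification[OF _ _ _ bound]) (use \<delta> in \<open>simp_all add: m_def\<close>)
  then obtain \<phi> :: "nat set \<Rightarrow> nat set" where \<phi>_off: "inj \<phi> \<and>
      (\<forall>a F. finite F \<longrightarrow> a \<notin> F \<longrightarrow> (\<Sum>b\<in>F. m (\<phi> a) (\<phi> b)) \<le> \<delta> / 2)"
    by (rule exE)
  then have \<phi>: "inj \<phi>" by (rule conjunct1)
  have off: "(\<Sum>b\<in>F. m (\<phi> a) (\<phi> b)) \<le> \<delta> / 2" if "finite F" "a \<notin> F" for a F
    using \<phi>_off that by simp
  obtain h :: "real \<Rightarrow> nat set" where h: "inj h" using inj_real_nat_set by blast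
  define \<rho> where "\<rho> r = \<iota> (\<phi> (h r))" for r
  have \<rho>: "inj \<rho>" by (rule injI) (auto simp: \<rho>_def dest!: injD[OF \<iota>(1)] injD[OF \<phi>] injD[OF h])
  have \<rho>S: "\<rho> r \<in> S n" for r using \<iota>(2) by (auto simp: \<rho>_def)
  have "equiv_l1_basis UNIV (\<lambda>r. f (\<rho> r))"
  proof (rule equiv_l1_basisI_finite)
    show "norm (f (\<rho> r)) \<le> real (Suc n)" for r using \<rho>S[of r] by (simp add: S_def)
    show "\<delta> / 2 > 0" using \<delta> by simp
    fix a :: "real \<Rightarrow> real" and F :: "real set" assume F: "finite F"
    have "(\<delta> - \<delta> / 2) * (\<Sum>r\<in>F. \<bar>a r\<bar>) \<le> norm (\<Sum>r\<in>F. a r *\<^sub>R f (\<rho> r))"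
      using F
    proof (rule norm_sum_ge_of_singular_parts)
      show "finite (B (\<rho> r) \<inter> B (\<rho> t))" if "r \<noteq> t" for r t
        using that by (intro ad) (simp add: inj_eq[OF \<rho>])
      show "\<delta> \<le> \<bar>sing (f (\<rho> r)) (B (\<rho> r))\<bar>" for r
        using \<rho>S[of r] by (simp add: S_def \<delta>_def)
      fix r assume "r \<in> F"
      have "(\<Sum>t\<in>F - {r}. \<bar>sing (f (\<rho> r)) (B (\<rho> t))\<bar>) = (\<Sum>b\<in>h ` (F - {r}). m (\<phi> (h r)) (\<phi> b))"
        using inj_on_subset[OF h] by (simp add: sum.reindex m_def \<rho>_def)
      also have "\<dots> \<le> \<delta> / 2"
        using F by (intro off) (auto simp: inj_eq[OF h])
      finally show "(\<Sum>t\<in>F - {r}. \<bar>sing (f (\<rho> r)) (B (\<rho> t))\<bar>) \<le> \<delta> / 2" .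
    qed
    then show "\<delta> / 2 * (\<Sum>r\<in>F. \<bar>a r\<bar>) \<le> norm (\<Sum>r\<in>F. a r *\<^sub>R f (\<rho> r))" by simp
  qed
  moreover have "range (\<lambda>r. f (\<rho> r)) \<subseteq> W" using f by auto
  ultimately have "\<exists>x :: real \<Rightarrow> linfty \<Rightarrow>\<^sub>L real. range x \<subseteq> W \<and> equiv_l1_basis UNIV x"
    by (intro exI conjI)
  with assms show False by (rule notE)
qed

end
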